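(* Assume that $G$ and $R$ are both standard in $T$: there exist constants $C>0$ and $\varepsilon_0>0$ such that for all $\varepsilon\in(0,\varepsilon_0]$ and all $t\in T$, $$P_X(B(t,\varepsilon))\ge C\,\mu(B(t,\varepsilon))\quad\text{and}\quad P_Y(B(t,\varepsilon))\ge C\,\mu(B(t,\varepsilon)).$$ Assume also that the function $F(\varepsilon):=\mu(B(T,\varepsilon))$, $\varepsilon\ge0$, is differentiable in a (right) neighborhood of $0$ and that its derivative $F'$ is continuous at $0$ (one-sided at $0$). Let $\{\varepsilon_n\}$ be a deterministic sequence of positive numbers with $\varepsilon_n\to0$. Then there is a constant $K>0$ (not depending on $n$) such that, for all $n$, $$E(L_n)\ge L(\varepsilon_n)-I_n,$$ where $$I_n=\frac{1}{\varepsilon_n}\int_{B(T,\varepsilon_n)}\exp\bigl(-Kn(\varepsilon_n-d(z,T))^d\bigr)\,dz .$$ Also, as $n\to\infty$, $$I_n=O\bigl((n\varepsilon_n^d)^{-1/d}\bigr).$$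
   Context: $\mu$ is Lebesgue measure on $\mathbb{R}^d$ and $\|\cdot\|$ the Euclidean norm; $B(x,\varepsilon)$ is the closed ball with center $x$ and radius $\varepsilon$, and for $A\subset\mathbb{R}^d$, $B(A,\varepsilon)=\bigcup_{x\in A}B(x,\varepsilon)$. $d(z,T)=\inf\{\|z-t\|:t\in T\}$. $G\subset(0,1)^d$ is a body (a compact set with $\mu(G)>0$), $R=[0,1]^d\setminus G$, and $T=\partial G$ is the boundary of $G$. For $\varepsilon>0$ let $L(\varepsilon)=\mu(B(T,\varepsilon))/(2\varepsilon)$. The Minkowski content $L_0=L_0(G)=\lim_{\varepsilon\to0^+}L(\varepsilon)$ is assumed to exist, to be finite and to be strictly positive. Sampling model: $(Z_1,\delta_1),(Z_2,\delta_2),\ldots$ are i.i.d. copies of $(Z,\delta)$, where $Z$ is uniformly distributed on $[0,1]^d$, $\delta=1$ if $Z\in G$ and $\delta=0$ if $Z\notin G$. $P_X$ and $P_Y$ denote the conditional distributions of $Z$ given $\delta=1$ and given $\delta=0$, i.e. the uniform distributions on $G$ and $R$ respectively. For $z\in[0,1]^d$ and $\varepsilon\ge0$, let $G_z(\varepsilon)=\#\{i\le n:\delta_i=1,\ \|Z_i-z\|\le\varepsilon\}$ and $R_z(\varepsilon)=\#\{i\le n:\delta_i=0,\ \|Z_i-z\|\le\varepsilon\}$ (both depend on $n$). Define $$T_n=\{z\in[0,1]^d: R_z(\varepsilon_n)\ge1\text{ and }G_z(\varepsilon_n)\ge1\},\qquad L_n=\frac{\mu(T_n)}{2\varepsilon_n}.$$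 *)

theory Defs
  imports "HOL-Probability.Probability" "HOL-Library.Landau_Symbols"
begin

text \<open>
  The space \<open>\<real>\<^sup>d\<close> is an arbitrary type of class \<^class>\<open>euclidean_space\<close>, with \<open>d = DIM('a)\<close>; in it
  \<open>cbox 0 One\<close> is \<open>[0,1]\<^sup>d\<close> and \<open>box 0 One\<close> is \<open>(0,1)\<^sup>d\<close>.  Every set that is measured below is
  Borel, so Lebesgue measure is taken to be \<^const>\<open>lborel\<close>.
\<close>

abbreviation unit_cube :: "'a::euclidean_space set" where
  "unit_cube \<equiv> cbox 0 One"

definition set_cball :: "'a::euclidean_space set \<Rightarrow> real \<Rightarrow> 'a set" where
  "set_cball A \<epsilon> = (\<Union>x\<in>A. cball x \<epsilon>)"

definition body :: "'a::euclidean_space set \<Rightarrow> bool" where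
  "body G \<longleftrightarrow> compact G \<and> G \<subseteq> box 0 One \<and> 0 < measure lborel G"

definition tube_volume :: "'a::euclidean_space set \<Rightarrow> real \<Rightarrow> real" where
  "tube_volume G \<epsilon> = measure lborel (set_cball (frontier G) \<epsilon>)"

definition boundary_content :: "'a::euclidean_space set \<Rightarrow> real \<Rightarrow> real" where
  "boundary_content G \<epsilon> = tube_volume G \<epsilon> / (2 * \<epsilon>)"

definition has_Minkowski_content :: "'a::euclidean_space set \<Rightarrow> real \<Rightarrow> bool" where
  "has_Minkowski_content G L0 \<longleftrightarrow> (boundary_content G \<longlongrightarrow> L0) (at_right 0)"

definition P_X :: "'a::euclidean_space set \<Rightarrow> 'a measure" where
  "P_X G = uniform_measure lborel G"

definition P_Y :: "'a::euclidean_space set \<Rightarrow> 'a measure" where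
  "P_Y G = uniform_measure lborel (unit_cube - G)"

text \<open>
  The constants \<open>C\<close> and \<open>\<epsilon>\<^sub>0\<close> are common to \<open>G\<close> and \<open>R = [0,1]\<^sup>d - G\<close>.
\<close>

definition both_standard :: "'a::euclidean_space set \<Rightarrow> bool" where
  "both_standard G \<longleftrightarrow>
     (\<exists>C>0. \<exists>\<epsilon>\<^sub>0>0. \<forall>\<epsilon>\<in>{0<..\<epsilon>\<^sub>0}. \<forall>t\<in>frontier G.
        measure (P_X G) (cball t \<epsilon>) \<ge> C * measure lborel (cball t \<epsilon>) \<and>
        measure (P_Y G) (cball t \<epsilon>) \<ge> C * measure lborel (cball t \<epsilon>))"

text \<open>
  One-sided differentiability on some \<open>[0,\<eta>)\<close>, the endpoint \<open>0\<close> included; relative to \<open>{0..}\<close>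
  the derivative at a positive point is the ordinary one.
\<close>

definition right_C1_at_0 :: "(real \<Rightarrow> real) \<Rightarrow> bool" where
  "right_C1_at_0 F \<longleftrightarrow>
     (\<exists>\<eta>>0. \<exists>F'. (\<forall>\<epsilon>\<in>{0..<\<eta>}. (F has_real_derivative F' \<epsilon>) (at \<epsilon> within {0..})) \<and>
                 continuous (at 0 within {0..}) F')"

text \<open>
  The pairs \<open>(Z\<^sub>i, \<delta>\<^sub>i)\<close>, \<open>i \<ge> 1\<close>, are independent, each with the law of \<open>(Z, 1\<^sub>G(Z))\<close> for \<open>Z\<close> uniform
  on \<open>[0,1]\<^sup>d\<close>.
\<close>

definition sampling_model ::
  "'w measure \<Rightarrow> (nat \<Rightarrow> 'w \<Rightarrow> 'a::euclidean_space) \<Rightarrow> (nat \<Rightarrow> 'w \<Rightarrow> nat) \<Rightarrow> 'a set \<Rightarrow> bool" where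
  "sampling_model M Z \<delta> G \<longleftrightarrow>
     prob_space M \<and>
     prob_space.indep_vars M (\<lambda>_. borel \<Otimes>\<^sub>M count_space UNIV) (\<lambda>i \<omega>. (Z i \<omega>, \<delta> i \<omega>)) {1..} \<and>
     (\<forall>i\<ge>1. distr M (borel \<Otimes>\<^sub>M count_space UNIV) (\<lambda>\<omega>. (Z i \<omega>, \<delta> i \<omega>)) =
             distr (uniform_measure lborel unit_cube) (borel \<Otimes>\<^sub>M count_space UNIV)
               (\<lambda>z. (z, if z \<in> G then 1 else 0)))"

definition G_count ::
  "(nat \<Rightarrow> 'w \<Rightarrow> 'a::euclidean_space) \<Rightarrow> (nat \<Rightarrow> 'w \<Rightarrow> nat) \<Rightarrow> nat \<Rightarrow> 'w \<Rightarrow> 'a \<Rightarrow> real \<Rightarrow> nat" where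
  "G_count Z \<delta> n \<omega> z \<epsilon> = card {i\<in>{1..n}. \<delta> i \<omega> = 1 \<and> norm (Z i \<omega> - z) \<le> \<epsilon>}"

definition R_count ::
  "(nat \<Rightarrow> 'w \<Rightarrow> 'a::euclidean_space) \<Rightarrow> (nat \<Rightarrow> 'w \<Rightarrow> nat) \<Rightarrow> nat \<Rightarrow> 'w \<Rightarrow> 'a \<Rightarrow> real \<Rightarrow> nat" where
  "R_count Z \<delta> n \<omega> z \<epsilon> = card {i\<in>{1..n}. \<delta> i \<omega> = 0 \<and> norm (Z i \<omega> - z) \<le> \<epsilon>}"

definition T_est ::
  "(nat \<Rightarrow> 'w \<Rightarrow> 'a::euclidean_space) \<Rightarrow> (nat \<Rightarrow> 'w \<Rightarrow> nat) \<Rightarrow> (nat \<Rightarrow> real) \<Rightarrow> nat \<Rightarrow> 'w \<Rightarrow> 'a set" where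
  "T_est Z \<delta> \<epsilon> n \<omega> =
     {z \<in> unit_cube. R_count Z \<delta> n \<omega> z (\<epsilon> n) \<ge> 1 \<and> G_count Z \<delta> n \<omega> z (\<epsilon> n) \<ge> 1}"

definition L_est ::
  "(nat \<Rightarrow> 'w \<Rightarrow> 'a::euclidean_space) \<Rightarrow> (nat \<Rightarrow> 'w \<Rightarrow> nat) \<Rightarrow> (nat \<Rightarrow> real) \<Rightarrow> nat \<Rightarrow> 'w \<Rightarrow> real" where
  "L_est Z \<delta> \<epsilon> n \<omega> = measure lborel (T_est Z \<delta> \<epsilon> n \<omega>) / (2 * \<epsilon> n)"

definition bias_term :: "'a::euclidean_space set \<Rightarrow> real \<Rightarrow> (nat \<Rightarrow> real) \<Rightarrow> nat \<Rightarrow> real" where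
  "bias_term G K \<epsilon> n =
     1 / \<epsilon> n * (LINT z:set_cball (frontier G) (\<epsilon> n)|lborel.
        exp (- K * real n * (\<epsilon> n - infdist z (frontier G)) ^ DIM('a)))"

end

theory Submission
  imports Defs
begin

text \<open>
  Write \<open>T\<close> for the boundary of \<open>G\<close> and \<open>R\<close> for the complement of \<open>G\<close> in the unit cube.

  \<^emph>\<open>Lower bound.\<close>  By Fubini the expected volume of the random set is the integral over \<open>z\<close> of
  the probability that the ball \<open>B(z, \<epsilon>)\<close> contains sample points of both kinds.  If \<open>t\<close> is a point
  of \<open>T\<close> nearest to \<open>z\<close>, then \<open>B(z, \<epsilon>)\<close> contains the ball about \<open>t\<close> of radius \<open>\<epsilon> - d(z, T)\<close>;
  standardness gives \<open>G\<close> and \<open>R\<close> a mass of at least \<open>c (\<epsilon> - d(z, T))\<^sup>d\<close> in it, so each kind is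
  missed by all \<open>n\<close> points with probability at most \<open>exp (- c n (\<epsilon> - d(z, T))\<^sup>d)\<close>.  A union
  bound for the two kinds, integrated over the tube and divided by \<open>2 \<epsilon>\<close>, is the claim
  (\<open>expected_volume_T_est_ge\<close>).  This uses that the tube lies in the cube and that \<open>\<epsilon>\<close> is in the range
  of the standardness condition, which is true for all but finitely many \<open>n\<close>.  For the remaining
  ones a smaller \<open>K\<close> makes the right-hand side nonpositive (\<open>boundary_content_le_bias_term\<close>).

  \<^emph>\<open>Order of the error.\<close>  The error is \<open>1 / \<epsilon>\<close> times the integral of
  \<open>exp (- K n (\<epsilon> - d(z, T))\<^sup>d)\<close>.  As the tube volume is Lipschitz near \<open>0\<close>, the distance to \<open>T\<close>
  has a bounded density on small tubes, and the integral is at most a multiple of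
  \<open>\<integral> exp (- K n u\<^sup>d) du\<close>, which is of order \<open>n powr (- 1 / d)\<close>.  \<open>tube_exp_integral_le\<close> carries
  this out by cutting the tube into shells of width \<open>n powr (- 1 / d)\<close>, on which the integrand
  decays geometrically.
\<close>

section \<open>Tubes around a compact set\<close>

lemma set_cball_eq_infdist:
  fixes T :: "'a::euclidean_space set"
  assumes "closed T" "T \<noteq> {}"
  shows "set_cball T r = {z. infdist z T \<le> r}"
proof (intro set_eqI iffI)
  fix z assume "z \<in> set_cball T r"
  then obtain t where "t \<in> T" "dist z t \<le> r"
    by (auto simp: set_cball_def dist_commute)
  then show "z \<in> {z. infdist z T \<le> r}"
    using infdist_le2 by blast
next
  fix z assume z: "z \<in> {z. infdist z T \<le> r}"
  obtain t where "t \<in> T" "infdist z T = dist z t"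
    using infdist_attains_inf[OF assms, of z] by auto
  then show "z \<in> set_cball T r"
    using z by (auto simp: set_cball_def dist_commute)
qed

lemma set_cball_mono: "r \<le> s \<Longrightarrow> set_cball T r \<subseteq> set_cball T s"
  by (force simp: set_cball_def)

lemma compact_set_cball:
  fixes T :: "'a::euclidean_space set"
  assumes "compact T" "T \<noteq> {}"
  shows "compact (set_cball T r)"
proof -
  have "closed {z. infdist z T \<le> r}"
    by (intro closed_Collect_le continuous_intros)
  moreover obtain B where B: "\<forall>t\<in>T. norm t \<le> B"
    using compact_imp_bounded[OF assms(1)] bounded_iff by blast
  have "bounded (set_cball T r)"
    unfolding bounded_iff
  proof (intro exI ballI)
    fix z assume "z \<in> set_cball T r"
    then obtain t where "t \<in> T" "dist t z \<le> r" by (auto simp: set_cball_def)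
    then show "norm z \<le> B + r"
      using B norm_triangle_sub[of z t] by (force simp: dist_norm norm_minus_commute)
  qed
  ultimately show ?thesis
    using set_cball_eq_infdist[OF compact_imp_closed[OF assms(1)] assms(2)]
    by (simp add: compact_eq_bounded_closed)
qed

lemma set_cball_subset_open:
  fixes T :: "'a::euclidean_space set"
  assumes "compact T" "open U" "T \<subseteq> U"
  shows "\<exists>e>0. set_cball T e \<subseteq> U"
proof -
  obtain e where e: "e > 0" "(\<Union>x\<in>T. ball x e) \<subseteq> U"
    using compact_subset_open_imp_ball_epsilon_subset[OF assms] by metis
  have "set_cball T (e/2) \<subseteq> (\<Union>x\<in>T. ball x e)"
    using e(1) by (force simp: set_cball_def)
  with e show ?thesis by (intro exI[of _ "e/2"]) auto
qed

lemma set_integrable_exp_tube: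
  fixes T :: "'a::euclidean_space set"
  assumes "compact T" "T \<noteq> {}"
  shows "set_integrable lborel (set_cball T e) (\<lambda>z. exp (c * (e - infdist z T) ^ k))"
  unfolding set_integrable_def
  by (intro borel_integrable_compact compact_set_cball assms continuous_intros)

section \<open>Laplace-type integrals over a tube\<close>

text \<open>
  With \<open>h = m powr (- 1 / d)\<close>, the integrand is at most \<open>exp (- K k)\<close> on the shell of points
  whose distance to \<open>T\<close> lies between \<open>e - (k + 1) h\<close> and \<open>e - k h\<close>, and by the Lipschitz
  condition that shell has volume at most \<open>D h\<close>; the geometric series sums these bounds.
  The set \<open>set_cball T 0\<close> is \<open>T\<close> itself; were it not null, the innermost shell would contain
  it and its volume would not be of order \<open>h\<close>.
\<close>

lemma tube_exp_integral_le:
  fixes T :: "'a::euclidean_space set"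
  assumes T: "compact T" "T \<noteq> {}"
    and null: "measure lborel (set_cball T 0) = 0"
    and lip: "\<And>a b. 0 \<le> a \<Longrightarrow> a \<le> b \<Longrightarrow> b \<le> e \<Longrightarrow>
      measure lborel (set_cball T b) - measure lborel (set_cball T a) \<le> D * (b - a)"
    and pos: "0 \<le> D" "0 < K" "0 < m" "0 < e"
  shows "(LINT z:set_cball T e|lborel. exp (- K * m * (e - infdist z T) ^ DIM('a)))
    \<le> D / (1 - exp (- K)) * m powr (- 1 / real DIM('a))"
proof -
  define F where "F s = measure lborel (set_cball T s)" for s
  define h where "h = m powr (- 1 / real DIM('a))"
  have h: "h > 0" "m * h ^ DIM('a) = 1"
  proof -
    show "h > 0" using pos by (simp add: h_def)
    have "h ^ DIM('a) = m powr (- 1)"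
      using pos by (simp add: h_def powr_powr flip: powr_realpow)
    then show "m * h ^ DIM('a) = 1" using pos by (simp add: powr_minus)
  qed
  have tube: "set_cball T s = {z. infdist z T \<le> s}" for s
    using set_cball_eq_infdist[OF compact_imp_closed[OF T(1)] T(2)] .
  have meas: "set_cball T s \<in> fmeasurable lborel" for s
    using compact_set_cball[OF T] by (simp add: fmeasurable_compact)
  \<comment> \<open>Tubes of negative radius are empty and \<open>T\<close> is null, so the Lipschitz bound extends to radii
    below \<open>0\<close> and the innermost, incomplete shell needs no separate treatment.\<close>
  have Flip: "F b - F a \<le> D * (b - a)" if ab: "a \<le> b" "b \<le> e" for a b
  proof -
    have neg: "F s = 0" if "s \<le> 0" for s
    proof -
      have "F s \<le> F 0" unfolding F_def
        by (intro measure_mono_fmeasurable set_cball_mono that fmeasurableD meas)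
      then show ?thesis using null by (simp add: F_def measure_le_0_iff)
    qed
    consider "0 \<le> a" | "b \<le> 0" | "a < 0" "0 < b" by linarith
    then show ?thesis
    proof cases
      case 1 then show ?thesis using lip ab by (simp add: F_def)
    next
      case 2 then show ?thesis using neg ab pos by simp
    next
      case 3
      have "F b - F 0 \<le> D * (b - 0)" using lip[of 0 b] ab 3 by (simp add: F_def)
      also have "D * (b - 0) \<le> D * (b - a)" using 3 pos by (intro mult_left_mono) auto
      finally show ?thesis using neg[of 0] neg[of a] 3 by simp
    qed
  qed
  define S where "S k = set_cball T (e - real k * h) - set_cball T (e - real (Suc k) * h)" for k
  have S_meas: "S k \<in> fmeasurable lborel" for k
    unfolding S_def by (intro fmeasurable_Diff meas fmeasurableD)
  have S_le: "measure lborel (S k) \<le> D * h" for k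
  proof -
    have "measure lborel (S k) = F (e - real k * h) - F (e - real (Suc k) * h)"
      unfolding S_def F_def using h
      by (intro measurable_measure_Diff meas fmeasurableD set_cball_mono) (simp add: algebra_simps)
    also have "\<dots> \<le> D * h"
      using Flip[of "e - real (Suc k) * h" "e - real k * h"] h pos by (simp add: algebra_simps)
    finally show ?thesis .
  qed
  obtain N :: nat where N: "e < real N * h"
    using h reals_Archimedean3[of h] by auto
  define g where "g z = indicator (set_cball T e) z *\<^sub>R exp (- K * m * (e - infdist z T) ^ DIM('a))" for z
  define s where "s z = (\<Sum>k<N. exp (- K) ^ k * indicator (S k) z)" for z :: 'a
  have g_le: "g z \<le> s z" for z
  proof (cases "z \<in> set_cball T e")
    case False
    then show ?thesis by (auto simp: g_def s_def intro!: sum_nonneg)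
  next
    case True
    define u where "u = (e - infdist z T) / h"
    have u: "0 \<le> u" "u < real N"
      using True N h infdist_nonneg[of z T] by (auto simp: u_def tube field_simps)
    define k where "k = nat \<lfloor>u\<rfloor>"
    have k: "real k \<le> u" "u < real (Suc k)"
      using u by (auto simp: k_def) linarith
    have kN: "k < N" using k u by linarith
    have zS: "z \<in> S k"
      using k h by (auto simp: S_def tube u_def field_simps)
    have "real k \<le> real k ^ DIM('a)"
    proof (cases k)
      case (Suc j)
      then show ?thesis using self_le_power[of "real k" "DIM('a)"] by simp
    qed simp
    also have "\<dots> \<le> u ^ DIM('a)" using k by (intro power_mono) auto
    also have "\<dots> = m * h ^ DIM('a) * u ^ DIM('a)" using h by simp
    also have "\<dots> = m * (e - infdist z T) ^ DIM('a)"
      using h(1) by (simp add: u_def power_divide)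
    finally have "K * real k \<le> K * (m * (e - infdist z T) ^ DIM('a))"
      using pos by simp
    then have "g z \<le> exp (- K) ^ k"
      using True by (simp add: g_def mult.commute mult.left_commute flip: exp_of_nat_mult)
    also have "\<dots> = exp (- K) ^ k * indicator (S k) z" using zS by simp
    also have "\<dots> \<le> s z" unfolding s_def
      using kN by (intro member_le_sum) auto
    finally show ?thesis .
  qed
  have int_s: "integrable lborel s" unfolding s_def
    using S_meas by (intro Bochner_Integration.integrable_sum integrable_mult_right integrable_real_indicator)
      (auto simp: fmeasurable_def)
  have int_g: "integrable lborel g"
    using set_integrable_exp_tube[OF T, of e "- K * m" "DIM('a)"]
    unfolding g_def set_integrable_def .
  have "(LINT z|lborel. g z) \<le> (LINT z|lborel. s z)"
    using int_g int_s g_le by (rule integral_mono)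
  also have "\<dots> = (\<Sum>k<N. exp (- K) ^ k * measure lborel (S k))"
    unfolding s_def using S_meas
    by (subst Bochner_Integration.integral_sum)
      (auto intro!: integrable_mult_right integrable_real_indicator simp: fmeasurable_def)
  also have "\<dots> \<le> (\<Sum>k<N. exp (- K) ^ k * (D * h))"
    by (intro sum_mono mult_left_mono S_le) auto
  also have "\<dots> = (\<Sum>k<N. exp (- K) ^ k) * (D * h)" by (simp add: sum_distrib_right)
  also have "\<dots> \<le> (1 / (1 - exp (- K))) * (D * h)"
  proof (intro mult_right_mono)
    have q: "0 \<le> exp (- K)" "norm (exp (- K)) < 1" using pos by auto
    have "(\<Sum>k<N. exp (- K) ^ k) \<le> (\<Sum>k. exp (- K) ^ k)"
      using q by (intro sum_le_suminf summable_geometric) auto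
    then show "(\<Sum>k<N. exp (- K) ^ k) \<le> 1 / (1 - exp (- K))"
      using suminf_geometric[OF q(2)] by simp
  qed (use pos h in auto)
  finally show ?thesis
    by (simp add: g_def h_def set_lebesgue_integral_def)
qed

text \<open>
  Continuity at \<open>0\<close> bounds the derivative near \<open>0\<close>, and the mean value theorem applies.
\<close>

lemma right_C1_at_0_imp_lipschitz:
  assumes "right_C1_at_0 F"
  shows "\<exists>e>0. \<exists>D\<ge>0. \<forall>a b. 0 \<le> a \<longrightarrow> a \<le> b \<longrightarrow> b \<le> e \<longrightarrow> F b - F a \<le> D * (b - a)"
proof -
  obtain \<eta> F' where \<eta>: "\<eta> > 0"
    and F': "\<And>x. x \<in> {0..<\<eta>} \<Longrightarrow> (F has_real_derivative F' x) (at x within {0..})"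
    and cont: "continuous (at 0 within {0..}) F'"
    using assms unfolding right_C1_at_0_def by blast
  obtain d where d: "d > 0" "\<And>x. x \<in> {0..} \<Longrightarrow> dist x 0 < d \<Longrightarrow> dist (F' x) (F' 0) < 1"
    using cont unfolding continuous_within_eps_delta by (metis zero_less_one)
  define e where "e = min \<eta> d / 2"
  have e: "e > 0" "e < \<eta>" "e < d" using \<eta> d by (auto simp: e_def min_def)
  have "F b - F a \<le> (\<bar>F' 0\<bar> + 1) * (b - a)" if ab: "0 \<le> a" "a \<le> b" "b \<le> e" for a b
  proof -
    have "norm (F b - F a) \<le> (\<bar>F' 0\<bar> + 1) * norm (b - a)"
    proof (rule field_differentiable_bound[of "{0..e}" F F'])
      show "(F has_real_derivative F' x) (at x within {0..e})" if "x \<in> {0..e}" for x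
        by (rule has_field_derivative_subset[OF F']) (use that e in auto)
      show "norm (F' x) \<le> \<bar>F' 0\<bar> + 1" if "x \<in> {0..e}" for x
        using d(2)[of x] that e by (auto simp: dist_real_def)
    qed (use ab in auto)
    then show ?thesis using ab by auto
  qed
  then show ?thesis
    by (intro exI[of _ e] conjI e(1) exI[of _ "\<bar>F' 0\<bar> + 1"]) auto
qed

section \<open>The random set\<close>

lemma fubini_random_set:
  fixes W :: "('w \<times> 'a::euclidean_space) set"
  assumes "prob_space M" "W \<in> sets (M \<Otimes>\<^sub>M lborel)" "W \<subseteq> space M \<times> C" "C \<in> fmeasurable lborel"
  shows "integrable lborel (\<lambda>z. measure M {\<omega> \<in> space M. (\<omega>, z) \<in> W})"
    and "(LINT \<omega>|M. measure lborel {z. (\<omega>, z) \<in> W}) =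
         (LINT z|lborel. measure M {\<omega> \<in> space M. (\<omega>, z) \<in> W})"
proof -
  interpret prob_space M by fact
  interpret pair_sigma_finite M "lborel :: 'a measure" ..
  have "emeasure (M \<Otimes>\<^sub>M lborel) W \<le> emeasure (M \<Otimes>\<^sub>M lborel) (space M \<times> C)"
    using assms by (intro emeasure_mono) auto
  also have "\<dots> = emeasure lborel C"
    using assms(4) by (simp add: lborel.emeasure_pair_measure_Times emeasure_space_1 fmeasurable_def)
  also have "\<dots> < \<infinity>" using assms(4) by (simp add: fmeasurable_def)
  finally have int: "integrable (M \<Otimes>\<^sub>M lborel) (\<lambda>(\<omega>, z). indicator W (\<omega>, z) :: real)"
    using assms(2) integrable_real_indicator[of W "M \<Otimes>\<^sub>M lborel"] by (simp add: split_def)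
  have 1: "(LINT z|lborel. indicator W (\<omega>, z)) = measure lborel {z. (\<omega>, z) \<in> W}" for \<omega>
  proof -
    have "(\<lambda>z. indicator W (\<omega>, z) :: real) = indicator {z. (\<omega>, z) \<in> W}"
      by (auto simp: indicator_def)
    then show ?thesis by simp
  qed
  have 2: "(LINT \<omega>|M. indicator W (\<omega>, z)) = measure M {\<omega> \<in> space M. (\<omega>, z) \<in> W}" for z
  proof -
    have "(\<lambda>\<omega>. indicator W (\<omega>, z) :: real) = indicator {\<omega>. (\<omega>, z) \<in> W}"
      by (auto simp: indicator_def)
    then show ?thesis by (simp add: Int_def conj_commute)
  qed
  show "integrable lborel (\<lambda>z. measure M {\<omega> \<in> space M. (\<omega>, z) \<in> W})"
    using integrable_snd[OF int] by (simp add: 2)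
  show "(LINT \<omega>|M. measure lborel {z. (\<omega>, z) \<in> W}) =
         (LINT z|lborel. measure M {\<omega> \<in> space M. (\<omega>, z) \<in> W})"
    using Fubini_integral[OF int] by (simp add: 1 2)
qed

lemma sampling_model_measurable:
  assumes "sampling_model M Z \<delta> G" "i \<ge> 1"
  shows "(\<lambda>\<omega>. (Z i \<omega>, \<delta> i \<omega>)) \<in> M \<rightarrow>\<^sub>M borel \<Otimes>\<^sub>M count_space UNIV"
    and "Z i \<in> borel_measurable M" and "\<delta> i \<in> M \<rightarrow>\<^sub>M count_space UNIV"
proof -
  interpret prob_space M using assms unfolding sampling_model_def by blast
  show *: "(\<lambda>\<omega>. (Z i \<omega>, \<delta> i \<omega>)) \<in> M \<rightarrow>\<^sub>M borel \<Otimes>\<^sub>M count_space UNIV"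
    using assms unfolding sampling_model_def indep_vars_def by auto
  show "Z i \<in> borel_measurable M" "\<delta> i \<in> M \<rightarrow>\<^sub>M count_space UNIV"
    using measurable_compose[OF * measurable_fst] measurable_compose[OF * measurable_snd] by simp_all
qed

text \<open>
  By independence the probability is \<open>(1 - p)\<^sup>n\<close>, where \<open>p\<close> is the chance that a single labelled
  point falls into \<open>S\<close>; then \<open>1 - p \<le> exp (- p)\<close>.  A set \<open>S\<close> of labelled points serves both
  kinds of sample points at once.
\<close>

lemma prob_sample_avoids_le:
  fixes G :: "'a::euclidean_space set"
  assumes model: "sampling_model M Z \<delta> G" and n: "n \<ge> 1" and G: "G \<in> sets borel"
    and S: "S \<in> sets (borel \<Otimes>\<^sub>M count_space UNIV)"
  shows "measure M {\<omega> \<in> space M. \<forall>i\<in>{1..n}. (Z i \<omega>, \<delta> i \<omega>) \<notin> S}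
    \<le> exp (- real n * measure lborel {z \<in> unit_cube. (z, if z \<in> G then 1 else 0) \<in> S})"
proof -
  interpret prob_space M using model unfolding sampling_model_def by blast
  let ?N = "borel \<Otimes>\<^sub>M count_space (UNIV :: nat set) :: ('a \<times> nat) measure"
  let ?U = "uniform_measure lborel (unit_cube :: 'a set)"
  let ?l = "\<lambda>z. (z, if z \<in> G then 1 else 0 :: nat)"
  define p where "p = measure lborel {z \<in> unit_cube. ?l z \<in> S}"
  have cube: "emeasure lborel (unit_cube :: 'a set) = 1"
    by (simp add: emeasure_lborel_cbox_eq)
  interpret U: prob_space ?U
    by (rule prob_space_uniform_measure) (simp_all add: cube)
  have l: "?l \<in> lborel \<rightarrow>\<^sub>M ?N" using G by measurable
  have lU: "?l \<in> ?U \<rightarrow>\<^sub>M ?N"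
    using l unfolding measurable_cong_sets[OF sets_uniform_measure refl] .
  have lS: "?l -` S \<in> sets borel" using measurable_sets[OF l S] by simp
  have Sc: "- S \<in> sets ?N" using sets.compl_sets[OF S] by (simp add: space_pair_measure Compl_eq_Diff_UNIV)
  have one: "prob ((\<lambda>\<omega>. (Z i \<omega>, \<delta> i \<omega>)) -` (- S) \<inter> space M) = 1 - p" if "i \<in> {1..n}" for i
  proof -
    have i: "i \<ge> 1" using that by simp
    have "prob ((\<lambda>\<omega>. (Z i \<omega>, \<delta> i \<omega>)) -` (- S) \<inter> space M)
        = measure (distr M ?N (\<lambda>\<omega>. (Z i \<omega>, \<delta> i \<omega>))) (- S)"
      using measure_distr[OF sampling_model_measurable(1)[OF model i] Sc] by simp
    also have "\<dots> = measure (distr ?U ?N ?l) (- S)"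
      using model i unfolding sampling_model_def by simp
    also have "\<dots> = measure ?U (?l -` (- S) \<inter> space ?U)"
      by (rule measure_distr[OF lU Sc])
    also have "?l -` (- S) \<inter> space ?U = space ?U - ?l -` S"
      by blast
    also have "measure ?U \<dots> = 1 - measure ?U (?l -` S)"
      by (rule U.prob_compl) (simp only: sets_uniform_measure sets_lborel lS)
    also have "measure ?U (?l -` S) = p"
    proof -
      have "emeasure ?U (?l -` S) = emeasure lborel (unit_cube \<inter> ?l -` S) / 1"
        unfolding cube[symmetric] by (rule emeasure_uniform_measure) (simp_all add: lS)
      also have "unit_cube \<inter> ?l -` S = {z \<in> unit_cube. ?l z \<in> S}"
        by blast
      also have "emeasure lborel \<dots> / 1 = emeasure lborel \<dots>"
        by (simp only: divide_ennreal_def ennreal_inverse_1 mult_1_right)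
      finally show ?thesis unfolding p_def measure_def by (rule arg_cong)
    qed
    finally show ?thesis .
  qed
  have "{\<omega> \<in> space M. \<forall>i\<in>{1..n}. (Z i \<omega>, \<delta> i \<omega>) \<notin> S}
      = (\<Inter>i\<in>{1..n}. (\<lambda>\<omega>. (Z i \<omega>, \<delta> i \<omega>)) -` (- S) \<inter> space M)"
    using n by auto
  also have "prob \<dots> = (\<Prod>i\<in>{1..n}. prob ((\<lambda>\<omega>. (Z i \<omega>, \<delta> i \<omega>)) -` (- S) \<inter> space M))"
    using model n Sc unfolding sampling_model_def
    by (intro indep_varsD[where I="{1..}" and M'="\<lambda>_. ?N"]) auto
  also have "\<dots> = (1 - p) ^ n" using one by simp
  also have "\<dots> \<le> exp (- p) ^ n"
  proof (rule power_mono)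
    show "1 - p \<le> exp (- p)" using exp_ge_add_one_self[of "- p"] by simp
    show "0 \<le> 1 - p" using one[of 1] n by (metis atLeastAtMost_iff measure_nonneg order_refl)
  qed
  also have "\<dots> = exp (- real n * p)" by (simp flip: exp_of_nat_mult)
  finally show ?thesis by (simp add: p_def)
qed

text \<open>
  Fubini turns the expected volume into an integral of hitting probabilities, each of which is
  estimated below by the mass that \<open>G\<close> and its complement have in a ball about the nearest point
  of \<open>T\<close>.  The factor \<open>2\<close> comes from the union bound over the two kinds of points.
\<close>

lemma expected_volume_T_est_ge:
  fixes G T :: "'a::euclidean_space set"
  assumes model: "sampling_model M Z \<delta> G" and n: "n \<ge> 1" and G: "G \<in> sets borel" "G \<subseteq> unit_cube"
    and T: "compact T" "T \<noteq> {}" and inside: "set_cball T (\<epsilon> n) \<subseteq> unit_cube"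
    and mass: "\<And>t r. t \<in> T \<Longrightarrow> 0 \<le> r \<Longrightarrow> r \<le> \<epsilon> n \<Longrightarrow>
      K * r ^ DIM('a) \<le> measure lborel (G \<inter> cball t r) \<and>
      K * r ^ DIM('a) \<le> measure lborel ((unit_cube - G) \<inter> cball t r)"
  shows "(LINT \<omega>|M. measure lborel (T_est Z \<delta> \<epsilon> n \<omega>)) \<ge>
    measure lborel (set_cball T (\<epsilon> n)) -
    2 * (LINT z:set_cball T (\<epsilon> n)|lborel. exp (- K * real n * (\<epsilon> n - infdist z T) ^ DIM('a)))"
proof -
  interpret prob_space M using model unfolding sampling_model_def by blast
  let ?e = "\<epsilon> n"
  let ?B = "set_cball T ?e"
  let ?x = "\<lambda>z. exp (- K * real n * (?e - infdist z T) ^ DIM('a))"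
  define hit where "hit j z \<omega> \<longleftrightarrow> (\<exists>i\<in>{1..n}. \<delta> i \<omega> = j \<and> norm (Z i \<omega> - z) \<le> ?e)" for j z \<omega>
  define W where "W = {(\<omega>, z) \<in> space M \<times> unit_cube. hit 0 z \<omega> \<and> hit 1 z \<omega>}"
  have T_est: "T_est Z \<delta> \<epsilon> n \<omega> = {z \<in> unit_cube. hit 0 z \<omega> \<and> hit 1 z \<omega>}" for \<omega>
    by (auto simp: T_est_def R_count_def G_count_def hit_def Suc_le_eq card_gt_0_iff)
  have [measurable]: "Z i \<in> borel_measurable M" "\<delta> i \<in> M \<rightarrow>\<^sub>M count_space UNIV" if "i \<in> {1..n}" for i
    using sampling_model_measurable[OF model, of i] that by auto
  have "Measurable.pred (M \<Otimes>\<^sub>M lborel) (\<lambda>x. hit j (snd x) (fst x))" for j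
    unfolding hit_def by measurable
  note [measurable] = this
  have [measurable]: "Measurable.pred M (\<lambda>\<omega>. hit j z \<omega>)" for j z
    unfolding hit_def by measurable
  have "W = {x \<in> space (M \<Otimes>\<^sub>M lborel). snd x \<in> unit_cube \<and> hit 0 (snd x) (fst x) \<and> hit 1 (snd x) (fst x)}"
    by (auto simp: W_def space_pair_measure)
  also have "\<dots> \<in> sets (M \<Otimes>\<^sub>M lborel)" by measurable
  finally have W: "W \<in> sets (M \<Otimes>\<^sub>M lborel)" "W \<subseteq> space M \<times> unit_cube"
    by (auto simp: W_def)
  have fin: "(unit_cube :: 'a set) \<in> fmeasurable lborel" by (simp add: fmeasurable_compact)
  note fubini = fubini_random_set[OF prob_space_axioms W fin]
  let ?q = "\<lambda>z. prob {\<omega> \<in> space M. (\<omega>, z) \<in> W}"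
  have avoid: "prob {\<omega> \<in> space M. \<not> hit j z \<omega>} \<le> ?x z" if z: "z \<in> ?B" and j: "j \<in> {0, 1}" for j z
  proof -
    obtain t where t: "t \<in> T" "infdist z T = dist z t"
      using infdist_attains_inf[OF compact_imp_closed[OF T(1)] T(2), of z] by auto
    \<comment> \<open>the largest radius for which the ball about \<open>t\<close> still fits into the ball about \<open>z\<close>\<close>
    define r where "r = ?e - infdist z T"
    have r: "0 \<le> r" "r \<le> ?e"
      using z set_cball_eq_infdist[OF compact_imp_closed[OF T(1)] T(2)] infdist_nonneg[of z T]
      by (auto simp: r_def)
    have ball: "cball t r \<subseteq> cball z ?e"
    proof
      fix x assume "x \<in> cball t r"
      then show "x \<in> cball z ?e"
        using dist_triangle[of z x t] t by (simp add: r_def)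
    qed
    define H where "H = (if j = 1 then G else unit_cube - G)"
    have H: "H \<in> sets borel" "H \<subseteq> unit_cube" using G by (auto simp: H_def)
    define S where "S = cball z ?e \<times> {j}"
    have S: "S \<in> sets (borel \<Otimes>\<^sub>M count_space UNIV)" by (auto simp: S_def)
    have "K * r ^ DIM('a) \<le> measure lborel (H \<inter> cball t r)"
      using mass[OF t(1) r] by (simp add: H_def)
    also have "\<dots> \<le> measure lborel (H \<inter> cball z ?e)"
    proof (rule measure_mono_fmeasurable)
      show "H \<inter> cball z ?e \<in> fmeasurable lborel"
        by (rule fmeasurableI2[OF fin]) (use H in auto)
    qed (use ball H in auto)
    also have "H \<inter> cball z ?e = {w \<in> unit_cube. (w, if w \<in> G then 1 else 0) \<in> S}"
      using j G by (auto simp: H_def S_def)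
    finally have "real n * (K * r ^ DIM('a))
        \<le> real n * measure lborel {w \<in> unit_cube. (w, if w \<in> G then 1 else 0) \<in> S}"
      by (intro mult_left_mono) auto
    moreover have "{\<omega> \<in> space M. \<not> hit j z \<omega>} = {\<omega> \<in> space M. \<forall>i\<in>{1..n}. (Z i \<omega>, \<delta> i \<omega>) \<notin> S}"
      by (auto simp: hit_def S_def dist_norm norm_minus_commute)
    moreover note prob_sample_avoids_le[OF model n G(1) S]
    ultimately show ?thesis
      by (simp add: r_def) (smt (verit) exp_le_cancel_iff mult.commute mult.left_commute)
  qed
  have q_ge: "1 - 2 * ?x z \<le> ?q z" if z: "z \<in> ?B" for z
  proof -
    have "1 = prob (space M)" by (simp add: prob_space)
    also have "space M = {\<omega> \<in> space M. (\<omega>, z) \<in> W} \<union>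
        ({\<omega> \<in> space M. \<not> hit 0 z \<omega>} \<union> {\<omega> \<in> space M. \<not> hit 1 z \<omega>})"
      using z inside by (auto simp: W_def)
    also have "prob \<dots> \<le> ?q z + prob ({\<omega> \<in> space M. \<not> hit 0 z \<omega>} \<union> {\<omega> \<in> space M. \<not> hit 1 z \<omega>})"
    proof (rule measure_Un_le)
      have "{\<omega> \<in> space M. (\<omega>, z) \<in> W} = {\<omega> \<in> space M. z \<in> unit_cube \<and> hit 0 z \<omega> \<and> hit 1 z \<omega>}"
        by (auto simp: W_def)
      then show "{\<omega> \<in> space M. (\<omega>, z) \<in> W} \<in> events" by simp
    qed measurable
    also have "\<dots> \<le> ?q z + (prob {\<omega> \<in> space M. \<not> hit 0 z \<omega>} + prob {\<omega> \<in> space M. \<not> hit 1 z \<omega>})"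
      by (intro add_left_mono measure_Un_le) measurable
    also have "\<dots> \<le> ?q z + (?x z + ?x z)"
      using avoid[OF z] by (intro add_left_mono add_mono) auto
    finally show ?thesis by simp
  qed
  have int_x: "set_integrable lborel ?B ?x"
    using set_integrable_exp_tube[OF T, of ?e "- K * real n" "DIM('a)"] .
  have B: "?B \<in> fmeasurable lborel" using compact_set_cball[OF T] by (simp add: fmeasurable_compact)
  have int_1: "set_integrable lborel ?B (\<lambda>_. 1 :: real)"
    using B by (simp add: set_integrable_def fmeasurable_def)
  have "measure lborel ?B - 2 * (LINT z:?B|lborel. ?x z) = (LINT z:?B|lborel. 1 - 2 * ?x z)"
    using int_x int_1 B by (subst set_integral_diff(2)) (auto simp: set_lebesgue_integral_def)
  also have "\<dots> \<le> (LINT z|lborel. ?q z)"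
    unfolding set_lebesgue_integral_def
  proof (rule integral_mono)
    show "integrable lborel (\<lambda>z. indicator ?B z *\<^sub>R (1 - 2 * ?x z))"
      using set_integral_diff(1)[OF int_1 set_integrable_mult_right[OF int_x], of 2]
      by (simp only: set_integrable_def)
    show "indicator ?B z *\<^sub>R (1 - 2 * ?x z) \<le> ?q z" for z
      using q_ge[of z] by (auto simp: indicator_def)
  qed (rule fubini(1))
  also have "\<dots> = (LINT \<omega>|M. measure lborel {z. (\<omega>, z) \<in> W})"
    using fubini(2) by simp
  also have "\<dots> = (LINT \<omega>|M. measure lborel (T_est Z \<delta> \<epsilon> n \<omega>))"
    by (intro Bochner_Integration.integral_cong refl arg_cong[where f="measure lborel"])
      (auto simp: W_def T_est)
  finally show ?thesis .
qed

text \<open>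
  The standardness condition speaks of the uniform distributions on \<open>G\<close> and on its complement;
  multiplying by the volumes of these sets gives bounds for Lebesgue measure.  The complement
  has positive volume because otherwise \<open>P_Y G\<close>, a quotient with numerator \<open>0\<close>, would vanish
  and the condition would fail at every boundary point.
\<close>

lemma both_standard_imp_ball_mass:
  fixes G :: "'a::euclidean_space set"
  assumes "body G" "both_standard G" "frontier G \<noteq> {}"
  shows "\<exists>c>0. \<exists>e>0. \<forall>t\<in>frontier G. \<forall>r. 0 \<le> r \<longrightarrow> r \<le> e \<longrightarrow>
      c * r ^ DIM('a) \<le> measure lborel (G \<inter> cball t r) \<and>
      c * r ^ DIM('a) \<le> measure lborel ((unit_cube - G) \<inter> cball t r)"
proof -
  obtain C e where C: "C > 0" "e > 0" and std: "\<And>r t. r \<in> {0<..e} \<Longrightarrow> t \<in> frontier G \<Longrightarrow>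
      measure (P_X G) (cball t r) \<ge> C * measure lborel (cball t r) \<and>
      measure (P_Y G) (cball t r) \<ge> C * measure lborel (cball t r)"
    using assms(2) unfolding both_standard_def by metis
  let ?R = "unit_cube - G"
  let ?v = "unit_ball_vol (real DIM('a))"
  have G: "compact G" "measure lborel G > 0" using assms(1) by (auto simp: body_def)
  have vol: "measure lborel (cball t r) = ?v * r ^ DIM('a)" if "r \<ge> 0" for t :: 'a and r
    using that by (simp add: measure_def emeasure_cball unit_ball_vol_nonneg)
  have v: "?v > 0" by simp
  have fG: "G \<in> fmeasurable lborel" using G by (simp add: fmeasurable_compact)
  have fR: "?R \<in> fmeasurable lborel"
    using G by (intro fmeasurable_Diff) (auto simp: fmeasurable_compact compact_imp_closed)
  have uni: "measure (uniform_measure lborel A) (cball t r) * measure lborel A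
      = measure lborel (A \<inter> cball t r)" if A: "A \<in> fmeasurable lborel" "measure lborel A > 0"
    for A :: "'a set" and t r
  proof -
    have "emeasure lborel A \<noteq> 0" "emeasure lborel A \<noteq> \<infinity>"
      using A by (auto simp: measure_def fmeasurable_def)
    then have "measure (uniform_measure lborel A) (cball t r)
        = measure lborel (A \<inter> cball t r) / measure lborel A"
      by (intro measure_uniform_measure) auto
    then show ?thesis using A by simp
  qed
  have R: "measure lborel ?R > 0"
  proof (rule ccontr)
    assume "\<not> measure lborel ?R > 0"
    then have "measure lborel ?R = 0" by (simp add: zero_less_measure_iff)
    then have "emeasure lborel ?R = 0" using fR by (simp add: emeasure_eq_measure2 fmeasurableD2)
    then have "emeasure lborel (?R \<inter> A) = 0" for A
      using fR by (meson Int_lower1 emeasure_eq_0 fmeasurableD)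
    moreover have "emeasure (P_Y G) (cball t r) = emeasure lborel (?R \<inter> cball t r) / emeasure lborel ?R"
      for t r unfolding P_Y_def using fR by (intro emeasure_uniform_measure) (auto dest: fmeasurableD)
    ultimately have "measure (P_Y G) (cball t r) = 0" for t r
      by (simp only: measure_def) simp
    moreover obtain t where "t \<in> frontier G" using assms(3) by auto
    ultimately have "C * (?v * e ^ DIM('a)) \<le> 0"
      using std[of e t] C vol[of e t] by simp
    moreover have "0 < C * (?v * e ^ DIM('a))"
      using C v by (intro mult_pos_pos zero_less_power)
    ultimately show False by linarith
  qed
  define c where "c = C * ?v * min (measure lborel G) (measure lborel ?R)"
  have "c > 0" using C v G R by (simp add: c_def)
  moreover have "c * r ^ DIM('a) \<le> measure lborel (G \<inter> cball t r) \<and>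
      c * r ^ DIM('a) \<le> measure lborel (?R \<inter> cball t r)"
    if t: "t \<in> frontier G" and r: "0 \<le> r" "r \<le> e" for t r
  proof (cases "r = 0")
    case False
    then have "r \<in> {0<..e}" using r by simp
    note s = std[OF this t, unfolded vol[OF r(1)] P_X_def P_Y_def]
    have gen: "c * r ^ DIM('a) \<le> measure lborel (A \<inter> cball t r)"
      if A: "A \<in> fmeasurable lborel" "measure lborel A > 0"
        "min (measure lborel G) (measure lborel ?R) \<le> measure lborel A"
        and "C * (?v * r ^ DIM('a)) \<le> measure (uniform_measure lborel A) (cball t r)" for A
    proof -
      have "c * r ^ DIM('a) = C * (?v * r ^ DIM('a)) * min (measure lborel G) (measure lborel ?R)"
        by (simp add: c_def)
      also have "\<dots> \<le> measure (uniform_measure lborel A) (cball t r) * measure lborel A"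
        using that by (intro mult_mono) auto
      finally show ?thesis using uni A by simp
    qed
    show ?thesis using gen[OF fG G(2)] gen[OF fR R] s by auto
  qed (simp add: zero_power)
  ultimately show ?thesis using C(2) by blast
qed

section \<open>The lower bound and the order of the error\<close>

text \<open>
  No hitting estimate is available at radii for which the tube leaves the cube or the mass bound
  fails.  There the claimed lower bound is made vacuous instead: while \<open>K n \<epsilon>\<^sup>d\<close> is at most
  \<open>ln 2\<close> the integrand is at least \<open>1/2\<close>, so that the error term is no smaller than the content.
\<close>

lemma boundary_content_le_bias_term:
  fixes G :: "'a::euclidean_space set"
  assumes T: "compact (frontier G)" "frontier G \<noteq> {}"
    and K: "0 < K" and en: "0 < \<epsilon> n"
    and small: "K * (real n * \<epsilon> n ^ DIM('a)) \<le> ln 2"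
  shows "boundary_content G (\<epsilon> n) \<le> bias_term G K \<epsilon> n"
proof -
  let ?T = "frontier G"
  have tube: "set_cball ?T r \<in> fmeasurable lborel" for r
    using compact_set_cball[OF T] by (simp add: fmeasurable_compact)
  let ?x = "\<lambda>z. exp (- K * real n * (\<epsilon> n - infdist z ?T) ^ DIM('a))"
  have x_ge: "1 / 2 \<le> ?x z" if "z \<in> set_cball ?T (\<epsilon> n)" for z
  proof -
    have "infdist z ?T \<le> \<epsilon> n"
      using that set_cball_eq_infdist[OF compact_imp_closed[OF T(1)] T(2)] by auto
    then have "(\<epsilon> n - infdist z ?T) ^ DIM('a) \<le> \<epsilon> n ^ DIM('a)"
      using infdist_nonneg[of z ?T] by (intro power_mono) auto
    then have "K * (real n * (\<epsilon> n - infdist z ?T) ^ DIM('a)) \<le> K * (real n * \<epsilon> n ^ DIM('a))"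
      using K by (intro mult_left_mono) auto
    then have "- ln 2 \<le> - K * real n * (\<epsilon> n - infdist z ?T) ^ DIM('a)" using small by (simp add: mult.assoc)
    then have "exp (- ln 2) \<le> ?x z" by (simp only: exp_le_cancel_iff)
    then show ?thesis by (simp add: exp_minus)
  qed
  have "tube_volume G (\<epsilon> n) / 2 = (LINT z:set_cball ?T (\<epsilon> n)|lborel. 1 / 2)"
    using tube by (simp add: tube_volume_def set_lebesgue_integral_def)
  also have "\<dots> \<le> (LINT z:set_cball ?T (\<epsilon> n)|lborel. ?x z)"
  proof (rule set_integral_mono)
    show "set_integrable lborel (set_cball ?T (\<epsilon> n)) ?x"
      using set_integrable_exp_tube[OF T, of "\<epsilon> n" "- K * real n" "DIM('a)"] .
    show "set_integrable lborel (set_cball ?T (\<epsilon> n)) (\<lambda>z. 1 / 2 :: real)"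
      using tube[of "\<epsilon> n"] by (simp add: set_integrable_def fmeasurable_def)
  qed (rule x_ge)
  finally have "tube_volume G (\<epsilon> n) / 2 * (1 / \<epsilon> n) \<le> bias_term G K \<epsilon> n"
    unfolding bias_term_def using en by (subst mult.commute) (intro mult_left_mono, auto)
  then show ?thesis
    by (simp add: boundary_content_def)
qed

theorem theorem2:
  fixes G :: "'a::euclidean_space set"
    and M :: "'w measure"
    and Z :: "nat \<Rightarrow> 'w \<Rightarrow> 'a"
    and \<delta> :: "nat \<Rightarrow> 'w \<Rightarrow> nat"
    and \<epsilon> :: "nat \<Rightarrow> real"
    and L0 :: real
  assumes "body G"
    and "has_Minkowski_content G L0" and "0 < L0"
    and "sampling_model M Z \<delta> G"
    and "both_standard G"
    and "right_C1_at_0 (tube_volume G)"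
    and "\<And>n. n \<ge> 1 \<Longrightarrow> 0 < \<epsilon> n" and "\<epsilon> \<longlonglongrightarrow> 0"
  shows "\<exists>K>0.
           (\<forall>n\<ge>1. prob_space.expectation M (L_est Z \<delta> \<epsilon> n)
                     \<ge> boundary_content G (\<epsilon> n) - bias_term G K \<epsilon> n) \<and>
           bias_term G K \<epsilon> \<in> O(\<lambda>n. (real n * \<epsilon> n ^ DIM('a)) powr (- 1 / real DIM('a)))"
proof -
  let ?T = "frontier G"
  have G: "compact G" "G \<subseteq> box 0 One" using assms(1) by (auto simp: body_def)
  have T: "compact ?T" "?T \<subseteq> box 0 One"
    using G compact_frontier frontier_subset_closed compact_imp_closed by blast+
  have T_ne: "?T \<noteq> {}"
  proof
    assume "?T = {}"
    then have "boundary_content G = (\<lambda>_. 0)"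
      by (auto simp: boundary_content_def tube_volume_def set_cball_def)
    then show False
      using assms(2,3) tendsto_unique[of "at_right (0::real)" "\<lambda>_. 0::real" L0 0]
      by (simp add: has_Minkowski_content_def)
  qed
  have fm: "set_cball ?T r \<in> fmeasurable lborel" for r
    using compact_set_cball[OF T(1) T_ne] by (simp add: fmeasurable_compact)
  \<comment> \<open>A finite content forces the tube volume to vanish with the radius, so \<open>T\<close> is null.\<close>
  have null: "measure lborel (set_cball ?T 0) = 0"
  proof -
    have "((\<lambda>r. boundary_content G r * (2 * r)) \<longlongrightarrow> L0 * (2 * 0)) (at_right 0)"
      using assms(2) unfolding has_Minkowski_content_def by (intro tendsto_intros)
    moreover have "\<forall>\<^sub>F r in at_right 0. tube_volume G 0 \<le> boundary_content G r * (2 * r)"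
      using eventually_at_right_less[of 0]
    proof eventually_elim
      case (elim r)
      have "tube_volume G 0 \<le> tube_volume G r" unfolding tube_volume_def
        using elim by (intro measure_mono_fmeasurable set_cball_mono fm fmeasurableD) auto
      then show ?case using elim by (simp add: boundary_content_def)
    qed
    ultimately have "tube_volume G 0 \<le> 0"
      using tendsto_lowerbound by fastforce
    then show ?thesis by (simp add: tube_volume_def measure_le_0_iff)
  qed
  obtain e1 D where D: "e1 > 0" "D \<ge> 0"
    "\<And>a b. 0 \<le> a \<Longrightarrow> a \<le> b \<Longrightarrow> b \<le> e1 \<Longrightarrow> tube_volume G b - tube_volume G a \<le> D * (b - a)"
    using right_C1_at_0_imp_lipschitz[OF assms(6)] by metis
  obtain e2 where e2: "e2 > 0" "set_cball ?T e2 \<subseteq> box 0 One"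
    using set_cball_subset_open[OF T(1) open_box T(2)] by blast
  obtain c e3 where c: "c > 0" "e3 > 0"
    "\<And>t r. t \<in> ?T \<Longrightarrow> 0 \<le> r \<Longrightarrow> r \<le> e3 \<Longrightarrow>
      c * r ^ DIM('a) \<le> measure lborel (G \<inter> cball t r) \<and>
      c * r ^ DIM('a) \<le> measure lborel ((unit_cube - G) \<inter> cball t r)"
    using both_standard_imp_ball_mass[OF assms(1,5) T_ne] by metis
  define e where "e = min e2 e3"
  have e: "e > 0" "e \<le> e2" "e \<le> e3" using e2 c by (auto simp: e_def)
  define Exceptional where "Exceptional = {n. n \<ge> 1 \<and> \<epsilon> n > e}"
  have "\<forall>\<^sub>F n in sequentially. \<epsilon> n < e"
    using assms(8) e(1) by (rule order_tendstoD)
  then obtain N where N: "\<And>n. n \<ge> N \<Longrightarrow> \<epsilon> n < e"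
    unfolding eventually_sequentially by blast
  have fin: "finite Exceptional"
    by (rule finite_subset[of _ "{..<N}"]) (use N in \<open>force simp: Exceptional_def not_less[symmetric]\<close>)+
  \<comment> \<open>The sum dominates \<open>n \<epsilon>\<^sup>d\<close> for every exceptional \<open>n\<close>, hence one \<open>K\<close> suits all of them.\<close>
  define s where "s = (\<Sum>n\<in>Exceptional. real n * \<epsilon> n ^ DIM('a))"
  have s_nonneg: "0 \<le> s"
    unfolding s_def using assms(7) by (intro sum_nonneg) (auto simp: Exceptional_def less_imp_le)
  define K where "K = min c (ln 2 / (1 + s))"
  have K: "0 < K" "K \<le> c" "K * (1 + s) \<le> ln 2"
  proof -
    show "0 < K" "K \<le> c" using c s_nonneg by (auto simp: K_def)
    have "K \<le> ln 2 / (1 + s)" by (simp add: K_def)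
    then show "K * (1 + s) \<le> ln 2" using s_nonneg by (simp add: pos_le_divide_eq)
  qed
  have ineq: "prob_space.expectation M (L_est Z \<delta> \<epsilon> n) \<ge> boundary_content G (\<epsilon> n) - bias_term G K \<epsilon> n"
    if n: "n \<ge> 1" for n
  proof (cases "n \<in> Exceptional")
    case False
    have en: "0 < \<epsilon> n" "\<epsilon> n \<le> e" using assms(7)[OF n] False n by (auto simp: Exceptional_def)
    let ?I = "LINT z:set_cball ?T (\<epsilon> n)|lborel. exp (- K * real n * (\<epsilon> n - infdist z ?T) ^ DIM('a))"
    have "measure lborel (set_cball ?T (\<epsilon> n)) - 2 * ?I
        \<le> (LINT \<omega>|M. measure lborel (T_est Z \<delta> \<epsilon> n \<omega>))"
    proof (rule expected_volume_T_est_ge[OF assms(4) n _ _ T(1) T_ne])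
      show "set_cball ?T (\<epsilon> n) \<subseteq> unit_cube"
        using set_cball_mono[of "\<epsilon> n" e2 ?T] en e e2(2) box_subset_cbox[of 0 One] by force
      show "K * r ^ DIM('a) \<le> measure lborel (G \<inter> cball t r) \<and>
          K * r ^ DIM('a) \<le> measure lborel ((unit_cube - G) \<inter> cball t r)"
        if "t \<in> ?T" "0 \<le> r" "r \<le> \<epsilon> n" for t r
      proof -
        have "K * r ^ DIM('a) \<le> c * r ^ DIM('a)" using K that by (intro mult_right_mono) auto
        then show ?thesis using c(3)[of t r] that en e by fastforce
      qed
    qed (use G box_subset_cbox[of 0 One] in \<open>auto simp: compact_imp_closed\<close>)
    then have "(measure lborel (set_cball ?T (\<epsilon> n)) - 2 * ?I) / (2 * \<epsilon> n)
        \<le> (LINT \<omega>|M. measure lborel (T_est Z \<delta> \<epsilon> n \<omega>)) / (2 * \<epsilon> n)"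
      using en by (intro divide_right_mono) auto
    moreover have "L_est Z \<delta> \<epsilon> n = (\<lambda>\<omega>. measure lborel (T_est Z \<delta> \<epsilon> n \<omega>) / (2 * \<epsilon> n))"
      by (simp add: L_est_def fun_eq_iff)
    ultimately show ?thesis
      using en by (simp add: boundary_content_def tube_volume_def bias_term_def diff_divide_distrib)
  next
    case True
    have en: "0 < \<epsilon> n" using assms(7)[OF n] .
    have "real n * \<epsilon> n ^ DIM('a) \<le> s" unfolding s_def
      using True fin assms(7) by (intro member_le_sum) (auto simp: Exceptional_def less_imp_le)
    then have "K * (real n * \<epsilon> n ^ DIM('a)) \<le> K * (1 + s)"
      using K by (intro mult_left_mono) auto
    then have small: "K * (real n * \<epsilon> n ^ DIM('a)) \<le> ln 2" using K(3) by linarith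
    have "boundary_content G (\<epsilon> n) \<le> bias_term G K \<epsilon> n"
      using boundary_content_le_bias_term[OF T(1) T_ne] K(1) en small by blast
    moreover have "0 \<le> (LINT \<omega>|M. L_est Z \<delta> \<epsilon> n \<omega>)"
      using en by (intro integral_nonneg_AE) (simp add: L_est_def)
    ultimately show ?thesis by linarith
  qed
  have "bias_term G K \<epsilon> \<in> O(\<lambda>n. (real n * \<epsilon> n ^ DIM('a)) powr (- 1 / real DIM('a)))"
  proof (rule bigoI)
    have "\<forall>\<^sub>F n in sequentially. \<epsilon> n < e1"
      using assms(8) D(1) by (rule order_tendstoD)
    then show "\<forall>\<^sub>F n in sequentially. norm (bias_term G K \<epsilon> n)
        \<le> D / (1 - exp (- K)) * norm ((real n * \<epsilon> n ^ DIM('a)) powr (- 1 / real DIM('a)))"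
      using eventually_ge_at_top[of 1]
    proof eventually_elim
      case (elim n)
      have en: "0 < \<epsilon> n" using assms(7) elim by simp
      let ?I = "LINT z:set_cball ?T (\<epsilon> n)|lborel. exp (- K * real n * (\<epsilon> n - infdist z ?T) ^ DIM('a))"
      have "?I \<le> D / (1 - exp (- K)) * real n powr (- 1 / real DIM('a))"
        using elim en D K
        by (intro tube_exp_integral_le T(1) T_ne null) (auto simp: tube_volume_def)
      then have "1 / \<epsilon> n * ?I \<le> 1 / \<epsilon> n * (D / (1 - exp (- K)) * real n powr (- 1 / real DIM('a)))"
        using en by (intro mult_left_mono) auto
      also have "\<dots> = D / (1 - exp (- K)) * (real n powr (- 1 / real DIM('a)) * (1 / \<epsilon> n))"
        by simp
      also have "\<dots> = D / (1 - exp (- K)) * (real n * \<epsilon> n ^ DIM('a)) powr (- 1 / real DIM('a))"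
      proof -
        have "(\<epsilon> n ^ DIM('a)) powr (- 1 / real DIM('a)) = 1 / \<epsilon> n"
          using en by (simp add: powr_powr powr_minus divide_inverse flip: powr_realpow)
        then show ?thesis by (simp only: powr_mult)
      qed
      finally have "bias_term G K \<epsilon> n
          \<le> D / (1 - exp (- K)) * (real n * \<epsilon> n ^ DIM('a)) powr (- 1 / real DIM('a))"
        by (simp only: bias_term_def)
      moreover have "0 \<le> bias_term G K \<epsilon> n"
        using en by (auto simp: bias_term_def set_lebesgue_integral_def intro!: integral_nonneg_AE)
      ultimately show ?case by simp
    qed
  qed
  with ineq K(1) show ?thesis by blast
qed

end
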